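(* Suppose that $\nu$ is a stationary tail measure on $\mathbf{F}$ with index $\alpha>0$. Then there exists a probability measure $\mathbb{Q}^*$ on $\mathbf{F}$ such that $$\nu=\mathbb{E}_{\mathbb{Q}^*}\iint\mathbf 1\{u\,\theta_sY\in\cdot,\,u>0\}\,\alpha u^{-\alpha-1}\,du\,\lambda(ds)$$ if and only if $$\int|Y_s|^\alpha\,\lambda(ds)<\infty\quad\nu\text{-a.e.}$$
   Context: $\mathbb{G}$ is a second countable locally compact Hausdorff Abelian group (additive, neutral element $0$) with Borel $\sigma$-field $\mathcal{G}$ and non-trivial Haar measure $\lambda$. $\mathbb{H}$ is a non-empty Polish space with Borel $\sigma$-field $\mathcal{H}$ which is a measurable cone: there is a measurable map $(u,x)\mapsto ux$ from $(0,\infty)\times\mathbb{H}$ to $\mathbb{H}$ with $1x=x$, $u(vx)=(uv)x$. $|\cdot|\colon\mathbb{H}\to[0,\infty)$ is measurable with $|ux|=u|x|$ for $u>0$; there is an element $x_0\in\mathbb{H}$ with $|x_0|=1$. For $\omega\in\mathbb{H}^{\mathbb{G}}$ let $\theta_s\omega:=\omega(\cdot+s)$ and $(u\omega)(s):=u\,\omega(s)$. $\mathbf{F}\subset\mathbb{H}^{\mathbb{G}}$ is a set of functions closed under all $\theta_s$ and under multiplication by $u\in(0,\infty)$, with a $\sigma$-field $\mathcal{F}$ such that $(\omega,s)\mapsto(\theta_s\omega,\omega(0))$ (on $\mathbf{F}\times\mathbb{G}$) and $(\omega,u)\mapsto u\omega$ (on $\mathbf{F}\times(0,\infty)$) are measurable.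 If $\mathbb{G}$ is discrete, $\mathbf{F}=\mathbb{H}^{\mathbb{G}}$ with the product $\sigma$-field. $Y_s(\omega):=\omega(s)$, and $Y=(Y_s)_{s\in\mathbb{G}}$ is the identity on $\mathbf{F}$. $\mathbb{E}_\mu$ denotes integration with respect to $\mu$. Let $\xi:=\int\mathbf 1\{s\in\cdot,\,|Y_s|>1\}\,\lambda(ds)$. A measure $\nu$ on $\mathbf{F}$ is a tail measure with index $\alpha>0$ if: $\int\mathbf 1\{|Y_s|>0\}\,\lambda(ds)>0$ $\nu$-a.e.; $\mathbb{E}_\nu\xi(B)<\infty$ for all compact $B\in\mathcal{G}$; and $\nu(uY\in\cdot)=u^\alpha\nu(Y\in\cdot)$ for all $u>0$. It is stationary if it is invariant under all shifts $\theta_s$; a stationary tail measure is always assumed normalized by $\nu(|Y_0|>1)=1$ (equivalently $\mathbb{E}_\nu\xi(B)=\lambda(B)$ for all $B\in\mathcal{G}$). *)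

theory Defs
  imports "HOL-Probability.Probability"
begin

(* On a second countable locally compact Hausdorff group every Borel measure that is finite on
   compact sets is regular, so regularity is not listed as a separate requirement. *)
definition haar_measure :: "'g::topological_ab_group_add measure \<Rightarrow> bool" where
  "haar_measure lam \<longleftrightarrow>
     sets lam = sets borel \<and>
     (\<forall>K. compact K \<longrightarrow> emeasure lam K < \<infinity>) \<and>
     (\<forall>t. distr lam borel (\<lambda>s. s + t) = lam) \<and>
     emeasure lam UNIV \<noteq> 0"

definition theta :: "'g::plus \<Rightarrow> ('g \<Rightarrow> 'h) \<Rightarrow> ('g \<Rightarrow> 'h)" where
  "theta s \<omega> = (\<lambda>t. \<omega> (t + s))"

(* The set of functions F together with its sigma-field is encoded as the measurable space
   underlying FF (space FF and sets FF); the values of the measure FF play no role.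
   smul u x is the product ux and is only constrained for u > 0; mag x is |x|. *)
locale tail_setting =
  fixes lam :: "'g::{topological_ab_group_add, t2_space, second_countable_topology} measure"
    and smul :: "real \<Rightarrow> 'h::polish_space \<Rightarrow> 'h"
    and mag :: "'h \<Rightarrow> real"
    and FF :: "('g \<Rightarrow> 'h) measure"
  assumes locally_compact: "locally_compact_space (euclidean :: 'g topology)"
    and haar: "haar_measure lam"
    and scale_measurable:
      "(\<lambda>(u, x). smul u x) \<in> restrict_space borel {0<..} \<Otimes>\<^sub>M borel \<rightarrow>\<^sub>M borel"
    and scale_one: "\<And>x. smul 1 x = x"
    and scale_scale: "\<And>u v x. u > 0 \<Longrightarrow> v > 0 \<Longrightarrow> smul u (smul v x) = smul (u * v) x"
    and mag_measurable: "mag \<in> borel \<rightarrow>\<^sub>M borel"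
    and mag_nonneg: "\<And>x. mag x \<ge> 0"
    and mag_scale: "\<And>u x. u > 0 \<Longrightarrow> mag (smul u x) = u * mag x"
    and mag_eq_one: "\<exists>x0. mag x0 = 1"
    and shift_closed: "\<And>s \<omega>. \<omega> \<in> space FF \<Longrightarrow> theta s \<omega> \<in> space FF"
    and scale_closed: "\<And>u \<omega>. u > 0 \<Longrightarrow> \<omega> \<in> space FF \<Longrightarrow> smul u \<circ> \<omega> \<in> space FF"
    and shift_eval_measurable:
      "(\<lambda>(\<omega>, s). (theta s \<omega>, \<omega> 0)) \<in> FF \<Otimes>\<^sub>M borel \<rightarrow>\<^sub>M FF \<Otimes>\<^sub>M borel"
    and scale_fun_measurable:
      "(\<lambda>(\<omega>, u). smul u \<circ> \<omega>) \<in> FF \<Otimes>\<^sub>M restrict_space borel {0<..} \<rightarrow>\<^sub>M FF"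
    and discrete:
      "(\<forall>S :: 'g set. open S) \<Longrightarrow>
         space FF = UNIV \<and> sets FF = sets (\<Pi>\<^sub>M s \<in> UNIV. (borel :: 'h measure))"

definition xi :: "'g measure \<Rightarrow> ('h \<Rightarrow> real) \<Rightarrow> ('g \<Rightarrow> 'h) \<Rightarrow> 'g set \<Rightarrow> ennreal" where
  "xi lam mag \<omega> B = (\<integral>\<^sup>+ s. indicator {s. s \<in> B \<and> mag (\<omega> s) > 1} s \<partial>lam)"

definition tail_measure ::
  "'g::topological_space measure \<Rightarrow> (real \<Rightarrow> 'h \<Rightarrow> 'h) \<Rightarrow> ('h \<Rightarrow> real) \<Rightarrow> ('g \<Rightarrow> 'h) measure \<Rightarrow>
     real \<Rightarrow> ('g \<Rightarrow> 'h) measure \<Rightarrow> bool" where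
  "tail_measure lam smul mag FF \<alpha> \<nu> \<longleftrightarrow>
     \<alpha> > 0 \<and> sets \<nu> = sets FF \<and>
     (AE \<omega> in \<nu>. (\<integral>\<^sup>+ s. indicator {s. mag (\<omega> s) > 0} s \<partial>lam) > 0) \<and>
     (\<forall>B. compact B \<longrightarrow> (\<integral>\<^sup>+ \<omega>. xi lam mag \<omega> B \<partial>\<nu>) < \<infinity>) \<and>
     (\<forall>u>0. \<forall>A\<in>sets FF.
        emeasure \<nu> {\<omega> \<in> space FF. smul u \<circ> \<omega> \<in> A} = ennreal (u powr \<alpha>) * emeasure \<nu> A)"

(* The last conjunct is the normalization that is part of the convention for stationary
   tail measures. *)
definition stationary_tail_measure ::
  "'g::{topological_space, monoid_add} measure \<Rightarrow> (real \<Rightarrow> 'h \<Rightarrow> 'h) \<Rightarrow> ('h \<Rightarrow> real) \<Rightarrow>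
     ('g \<Rightarrow> 'h) measure \<Rightarrow> real \<Rightarrow> ('g \<Rightarrow> 'h) measure \<Rightarrow> bool" where
  "stationary_tail_measure lam smul mag FF \<alpha> \<nu> \<longleftrightarrow>
     tail_measure lam smul mag FF \<alpha> \<nu> \<and>
     (\<forall>s. distr \<nu> FF (theta s) = \<nu>) \<and>
     emeasure \<nu> {\<omega> \<in> space FF. mag (\<omega> 0) > 1} = 1"

end

theory Submission
  imports Defs
begin

text \<open>
  Write \<open>N \<omega>\<close> for the integral of \<open>|\<omega> s| powr \<alpha>\<close> over the group (\<open>mass\<close> below). It is shift invariant
  and homogeneous of degree \<open>\<alpha>\<close>. If \<open>Q\<close> represents \<open>\<nu>\<close>, then \<open>E\<^sub>Q N = \<nu>(|Y\<^sub>0| > 1) = 1\<close>, so \<open>N\<close> is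
  finite \<open>Q\<close>-almost everywhere; since \<open>{N = \<infinity>}\<close> is invariant under shifts and dilations, it
  is also \<open>\<nu>\<close>-null. Conversely, if \<open>0 < N < \<infinity>\<close> holds \<open>\<nu>\<close>-almost everywhere, put
  \<open>r = N powr (1 / \<alpha>)\<close> and \<open>h \<omega> = (|\<omega> 0| / r \<omega>) powr \<alpha> * 1{1 \<le> r \<omega> \<le> exp (1 / \<alpha>)}\<close>. The integral
  of \<open>h\<close> along the orbit of \<open>\<omega>\<close> under shifts and dilations is \<open>1\<close>, so disintegrating \<open>\<nu>\<close> along
  orbits yields a representation by the measure \<open>h \<nu>\<close>. Dividing the paths by \<open>r\<close> and compensating
  by the density \<open>N\<close> does not change it, but forces \<open>N = 1\<close>; the total mass is then \<open>E\<^sub>Q N = 1\<close>.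
\<close>

section \<open>Haar measure on a locally compact Abelian group\<close>

text \<open>Each point has an open neighbourhood inside a compact set, and by Lindelof countably
  many of these neighbourhoods cover the space.\<close>

lemma locally_compact_sigma_compact:
  assumes "locally_compact_space (euclidean :: 'a::second_countable_topology topology)"
  obtains K :: "nat \<Rightarrow> 'a::second_countable_topology set" where "\<And>n. compact (K n)" "(\<Union>n. K n) = UNIV"
proof -
  have "\<exists>U K. open U \<and> compact K \<and> x \<in> U \<and> U \<subseteq> K" for x :: 'a
    using assms by (auto simp: locally_compact_space_def)
  then obtain U K where UK: "\<And>x :: 'a. open (U x)" "\<And>x. compact (K x)" "\<And>x. x \<in> U x" "\<And>x. U x \<subseteq> K x"
    by metis
  obtain D where D: "D \<subseteq> range U" "countable D" "\<Union>D = \<Union>(range U)"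
    using Lindelof[of "range U"] UK(1) by blast
  obtain X where X: "countable X" "D = U ` X"
    using D countable_subset_image[of D U UNIV] by auto
  have cover: "(\<Union>x\<in>X. U x) = UNIV"
    using D X UK(3) by auto
  show thesis
  proof
    show "compact (K (from_nat_into X n))" for n by (rule UK)
    show "(\<Union>n. K (from_nat_into X n)) = UNIV"
    proof (safe; simp)
      fix y
      obtain x where "x \<in> X" "y \<in> U x" using cover by blast
      then show "\<exists>n. y \<in> K (from_nat_into X n)"
        using UK(4)[of x] from_nat_into_surj[OF X(1), of x] by blast
    qed
  qed
qed

lemma borel_measurable_uminus_group [measurable]:
  "(uminus :: 'g::{topological_ab_group_add, t2_space} \<Rightarrow> 'g) \<in> borel_measurable borel"
  by (intro borel_measurable_continuous_onI continuous_intros)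

lemma sets_haar: "haar_measure lam \<Longrightarrow> sets lam = sets borel"
  by (simp add: haar_measure_def)

lemma nn_integral_haar_translate:
  fixes lam :: "'g::{topological_ab_group_add, second_countable_topology} measure"
  assumes "haar_measure lam" and [measurable]: "f \<in> borel_measurable borel"
  shows "(\<integral>\<^sup>+ s. f (s + t) \<partial>lam) = (\<integral>\<^sup>+ s. f s \<partial>lam)"
proof -
  have [measurable_cong]: "sets lam = sets borel"
    using assms by (simp add: sets_haar)
  have "(\<integral>\<^sup>+ s. f s \<partial>lam) = (\<integral>\<^sup>+ s. f s \<partial>distr lam borel (\<lambda>s. s + t))"
    using assms by (simp add: haar_measure_def)
  then show ?thesis
    by (simp add: nn_integral_distr)
qed

lemma haar_sigma_finite:
  fixes lam :: "'g::{topological_ab_group_add, t2_space, second_countable_topology} measure"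
  assumes "locally_compact_space (euclidean :: 'g topology)" "haar_measure lam"
  shows "sigma_finite_measure lam"
proof -
  obtain K :: "nat \<Rightarrow> 'g set" where K: "\<And>n. compact (K n)" "(\<Union>n. K n) = UNIV"
    using locally_compact_sigma_compact[OF assms(1)] by blast
  have "space lam = UNIV"
    using sets_eq_imp_space_eq[OF sets_haar[OF assms(2)]] by simp
  then show ?thesis
    using assms(2) K
    by (intro sigma_finite_measure.intro exI[of _ "range K"])
      (auto simp: haar_measure_def less_top compact_imp_closed)
qed

text \<open>Uniqueness of Haar measure is not needed: the integral of \<open>f (s - t)\<close> over
  \<open>s\<close> in the group and \<open>t\<close> in a set of positive finite measure, evaluated in both orders,
  compares \<open>f\<close> with its reflection.\<close>
lemma nn_integral_haar_uminus:
  fixes lam :: "'g::{topological_ab_group_add, t2_space, second_countable_topology} measure"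
  assumes "locally_compact_space (euclidean :: 'g topology)" and haar: "haar_measure lam"
    and [measurable]: "f \<in> borel_measurable borel"
  shows "(\<integral>\<^sup>+ s. f (- s) \<partial>lam) = (\<integral>\<^sup>+ s. f s \<partial>lam)"
proof -
  have [measurable_cong]: "sets lam = sets borel"
    using haar by (rule sets_haar)
  interpret sigma_finite_measure lam
    by (rule haar_sigma_finite) fact+
  interpret pair_sigma_finite lam lam ..
  note add_uminus_conv_diff [simp del]
  obtain K :: "nat \<Rightarrow> 'g set" where K: "\<And>n. compact (K n)" "(\<Union>n. K n) = UNIV"
    using locally_compact_sigma_compact[OF assms(1)] by blast
  have "range K \<subseteq> sets lam"
    using K haar by (auto simp: haar_measure_def compact_imp_closed)
  then obtain n where n: "emeasure lam (K n) \<noteq> 0"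
    using emeasure_UN_eq_0[of lam K] K(2) haar by (auto simp: haar_measure_def)
  define B where "B = K n"
  have [measurable]: "B \<in> sets borel"
    using K by (simp add: B_def compact_imp_closed)
  have B: "emeasure lam B \<noteq> 0" "emeasure lam B \<noteq> \<infinity>"
    using n K(1)[of n] haar by (auto simp: B_def haar_measure_def less_top)
  have "(\<integral>\<^sup>+ s. f s \<partial>lam) * emeasure lam B = (\<integral>\<^sup>+ t. (\<integral>\<^sup>+ s. f s \<partial>lam) * indicator B t \<partial>lam)"
    by (simp add: nn_integral_cmult)
  also have "\<dots> = (\<integral>\<^sup>+ t. (\<integral>\<^sup>+ s. f (s + - t) \<partial>lam) * indicator B t \<partial>lam)"
    by (simp only: nn_integral_haar_translate[OF haar \<open>f \<in> _\<close>])
  also have "\<dots> = (\<integral>\<^sup>+ t. (\<integral>\<^sup>+ s. f (s + - t) * indicator B t \<partial>lam) \<partial>lam)"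
    by (simp add: nn_integral_multc)
  also have "\<dots> = (\<integral>\<^sup>+ s. (\<integral>\<^sup>+ t. f (s + - t) * indicator B t \<partial>lam) \<partial>lam)"
    by (rule Fubini') measurable
  \<comment> \<open>Translating \<open>t\<close> by \<open>s\<close> turns \<open>s - t\<close> into
    \<open>- t\<close> and moves \<open>s\<close> into the indicator.\<close>
  also have "\<dots> = (\<integral>\<^sup>+ s. (\<integral>\<^sup>+ t. f (- t) * indicator B (t + s) \<partial>lam) \<partial>lam)"
  proof (rule nn_integral_cong)
    fix s
    show "(\<integral>\<^sup>+ t. f (s + - t) * indicator B t \<partial>lam) = (\<integral>\<^sup>+ t. f (- t) * indicator B (t + s) \<partial>lam)"
      using nn_integral_haar_translate[OF haar, of "\<lambda>t. f (s + - t) * indicator B t" s]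
      by (simp add: ac_simps)
  qed
  also have "\<dots> = (\<integral>\<^sup>+ t. (\<integral>\<^sup>+ s. f (- t) * indicator B (t + s) \<partial>lam) \<partial>lam)"
    by (rule Fubini') measurable
  also have "\<dots> = (\<integral>\<^sup>+ t. f (- t) * (\<integral>\<^sup>+ s. indicator B (s + t) \<partial>lam) \<partial>lam)"
    by (simp add: nn_integral_cmult add.commute)
  also have "\<dots> = (\<integral>\<^sup>+ t. f (- t) * emeasure lam B \<partial>lam)"
    using nn_integral_haar_translate[OF haar, of "indicator B"] by simp
  also have "\<dots> = (\<integral>\<^sup>+ t. f (- t) \<partial>lam) * emeasure lam B"
    by (simp add: nn_integral_multc)
  finally show ?thesis
    using B by (simp add: mult.commute[of _ "emeasure lam B"] ennreal_mult_cancel_left)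
qed

text \<open>By Markov's inequality each set where \<open>f i\<close> is at least
  \<open>1 / n\<close> has finite measure, and by \<open>pos\<close> these countably many sets cover
  all but a null set.\<close>

lemma sigma_finite_measure_if_countable_integrable:
  fixes f :: "'i::countable \<Rightarrow> 'a \<Rightarrow> ennreal"
  assumes [measurable]: "\<And>i. f i \<in> borel_measurable M"
    and fin: "\<And>i. (\<integral>\<^sup>+ x. f i x \<partial>M) < \<infinity>"
    and pos: "AE x in M. \<exists>i. f i x > 0"
  shows "sigma_finite_measure M"
proof
  define S where "S = (\<lambda>(i, n::nat). {x \<in> space M. 1 \<le> of_nat n * f i x})"
  have [measurable]: "S p \<in> sets M" for p
    by (auto simp: S_def split: prod.split)
  have S: "emeasure M (S (i, n)) < \<infinity>" for i n
  proof -
    have "emeasure M (S (i, n)) \<le> of_nat n * (\<integral>\<^sup>+ x. f i x * indicator (space M) x \<partial>M)"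
      unfolding S_def prod.case by (rule nn_integral_Markov_inequality) auto
    also have "(\<integral>\<^sup>+ x. f i x * indicator (space M) x \<partial>M) = (\<integral>\<^sup>+ x. f i x \<partial>M)"
      by (intro nn_integral_cong) auto
    also have "of_nat n * \<dots> < \<infinity>"
      using fin by (simp add: ennreal_mult_less_top ennreal_of_nat_eq_real_of_nat)
    finally show ?thesis .
  qed
  define Z where "Z = space M - (\<Union>p. S p)"
  have "AE x in M. x \<notin> Z"
    using pos
  proof eventually_elim
    case (elim x)
    then obtain i where i: "f i x > 0" by blast
    have "\<exists>n. 1 \<le> of_nat n * f i x"
    proof (cases "f i x")
      case (real r)
      then obtain n where "1 < real n * r"
        using i reals_Archimedean3[of r] by (auto simp: ennreal_less_zero_iff)
      then have "1 \<le> of_nat n * f i x"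
        using real by (simp add: ennreal_of_nat_eq_real_of_nat flip: ennreal_mult ennreal_1 del: ennreal_1)
      then show ?thesis ..
    next
      case top
      then have "1 \<le> of_nat 1 * f i x" by simp
      then show ?thesis ..
    qed
    then show ?case by (auto simp: Z_def S_def)
  qed
  moreover have [measurable]: "Z \<in> sets M" unfolding Z_def by measurable
  ultimately have "Z \<in> null_sets M"
    by (simp add: AE_iff_null_sets)
  then show "\<exists>A. countable A \<and> A \<subseteq> sets M \<and> \<Union> A = space M \<and> (\<forall>a\<in>A. emeasure M a \<noteq> \<infinity>)"
    using S
    by (intro exI[of _ "insert Z (range S)"]) (auto simp: Z_def S_def less_top)
qed

section \<open>Two integrals over the positive half-line\<close>

text \<open>For \<open>m > 0\<close> the integral runs over \<open>u > 1 / m\<close>, and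
  \<open>- (u powr - a)\<close> is an antiderivative of the Pareto density. For \<open>m = 0\<close>
  both sides vanish, as \<open>0 powr a = 0\<close>.\<close>

lemma nn_integral_Pareto_tail:
  fixes a m :: real
  assumes "a > 0" "m \<ge> 0"
  shows "(\<integral>\<^sup>+ u. indicator {u. 1 < u * m} u * (ennreal (a * u powr (- a - 1)) * indicator {0<..} u) \<partial>lborel)
    = ennreal (m powr a)"
proof (cases "m = 0")
  case False
  with assms have m: "m > 0" by simp
  \<comment> \<open>Ignoring one point allows the open ray to be replaced by the closed one in the
    fundamental theorem of calculus.\<close>
  have "AE u in lborel. u \<noteq> 1 / m"
    by (rule AE_lborel_singleton)
  then have "(\<integral>\<^sup>+ u. indicator {u. 1 < u * m} u * (ennreal (a * u powr (- a - 1)) * indicator {0<..} u) \<partial>lborel)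
    = (\<integral>\<^sup>+ u. ennreal (a * u powr (- a - 1)) * indicator {1 / m..} u \<partial>lborel)"
  proof (intro nn_integral_cong_AE, eventually_elim)
    case (elim u)
    have "u > 0" if "1 \<le> m * u"
      using that m by (intro zero_less_mult_pos[of m u]) auto
    then show ?case
      using m elim by (auto simp: indicator_def field_simps)
  qed
  also have "\<dots> = ennreal (0 - (- ((1 / m) powr - a)))"
  proof (rule nn_integral_FTC_atLeast)
    have "((\<lambda>u. - (u powr - a)) \<longlongrightarrow> - 0) at_top"
      using assms by (intro tendsto_minus tendsto_neg_powr filterlim_ident) auto
    then show "((\<lambda>u. - (u powr - a)) \<longlongrightarrow> 0) at_top" by simp
    show "((\<lambda>u. - (u powr - a)) has_real_derivative a * u powr (- a - 1)) (at u)" if "1 / m \<le> u" for u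
    proof -
      have "1 / m > 0" using m by simp
      with that have "u > 0" by linarith
      then show ?thesis by (auto intro!: derivative_eq_intros)
    qed
  qed (use assms in auto)
  also have "0 - (- ((1 / m) powr - a)) = m powr a"
    using m by (simp add: powr_minus powr_divide)
  finally show ?thesis .
qed simp

text \<open>The density \<open>a / u\<close> gives \<open>a\<close> times logarithmic Lebesgue
  measure, which is invariant under passing from \<open>u\<close> to \<open>r / u\<close>. The
  window has logarithmic length \<open>1 / a\<close>, hence mass 1 for every
  \<open>r\<close>.\<close>

lemma nn_integral_inverse_exp:
  fixes a r :: real
  assumes "a > 0" "r > 0"
  shows "(\<integral>\<^sup>+ u. indicator {1..exp (1 / a)} (r / u) * (ennreal (a / u) * indicator {0<..} u) \<partial>lborel) = 1"
proof -
  have "(\<integral>\<^sup>+ u. indicator {1..exp (1 / a)} (r / u) * (ennreal (a / u) * indicator {0<..} u) \<partial>lborel)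
    = (\<integral>\<^sup>+ u. ennreal (a / u) * indicator {r / exp (1 / a)..r} u \<partial>lborel)"
  proof (intro nn_integral_cong)
    fix u :: real
    have "u > 0" if "r \<le> u * exp (1 / a)"
      using that assms by (intro zero_less_mult_pos2[of u "exp (1 / a)"]) auto
    then show "indicator {1..exp (1 / a)} (r / u) * (ennreal (a / u) * indicator {0<..} u)
        = ennreal (a / u) * indicator {r / exp (1 / a)..r} u"
      using assms by (cases "u > 0") (auto simp: indicator_def field_simps)
  qed
  also have "\<dots> = ennreal (a * ln r - a * ln (r / exp (1 / a)))"
  proof (rule nn_integral_FTC_Icc)
    show "r / exp (1 / a) \<le> r"
      using assms by (simp add: field_simps)
    show "((\<lambda>u. a * ln u) has_real_derivative a / u) (at u)"
      if "u \<in> {r / exp (1 / a)..r}" for u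
    proof -
      have "r / exp (1 / a) > 0" using assms by simp
      with that have "u > 0" by auto
      then show ?thesis
        by (auto intro!: derivative_eq_intros)
    qed
    show "0 \<le> a / u" if "u \<in> {r / exp (1 / a)..r}" for u
    proof -
      have "r / exp (1 / a) > 0" using assms by simp
      with that assms show ?thesis by auto
    qed
  qed simp
  also have "a * ln r - a * ln (r / exp (1 / a)) = 1"
    using assms by (simp add: ln_div algebra_simps)
  finally show ?thesis by simp
qed

section \<open>The action of shifts and dilations\<close>

context tail_setting
begin

declare shift_closed [simp]

lemma sets_lam [measurable_cong]: "sets lam = sets borel"
  using haar by (rule sets_haar)

lemma space_lam [simp]: "space lam = UNIV"
  using sets_eq_imp_space_eq[OF sets_lam] by simp

sublocale lam: sigma_finite_measure lam
  using locally_compact haar by (rule haar_sigma_finite)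

lemma theta_apply: "theta s \<omega> t = \<omega> (t + s)"
  by (simp add: theta_def)

lemma theta_theta: "theta s (theta t \<omega>) = theta (s + t) (\<omega> :: 'g \<Rightarrow> 'h)"
  by (simp add: theta_def fun_eq_iff add.assoc)

lemma theta_0: "theta 0 \<omega> = (\<omega> :: 'g \<Rightarrow> 'h)"
  by (simp add: theta_def)

text \<open>The map \<open>smul u\<close> is constrained only for positive \<open>u\<close>.
  Replacing other factors by 1 gives a map of \<open>space FF\<close> into itself that is jointly
  measurable in \<open>u\<close> and \<open>\<omega>\<close> over the whole real line.\<close>

definition dil :: "real \<Rightarrow> ('g \<Rightarrow> 'h) \<Rightarrow> 'g \<Rightarrow> 'h" where
  "dil u \<omega> = smul (if u > 0 then u else 1) \<circ> \<omega>"

lemma dil_pos: "u > 0 \<Longrightarrow> dil u \<omega> = smul u \<circ> \<omega>"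
  by (simp add: dil_def)

lemma dil_1: "dil 1 \<omega> = \<omega>"
  by (simp add: dil_def scale_one fun_eq_iff)

lemma dil_dil: "u > 0 \<Longrightarrow> v > 0 \<Longrightarrow> dil u (dil v \<omega>) = dil (u * v) \<omega>"
  by (simp add: dil_def scale_scale fun_eq_iff)

lemma theta_dil: "theta s (dil u \<omega>) = dil u (theta s \<omega>)"
  by (simp add: theta_def dil_def fun_eq_iff)

lemma mag_dil: "u > 0 \<Longrightarrow> mag (dil u \<omega> s) = u * mag (\<omega> s)"
  by (simp add: dil_def mag_scale)

lemma measurable_theta [measurable (raw)]:
  assumes [measurable]: "f \<in> M \<rightarrow>\<^sub>M FF" "g \<in> M \<rightarrow>\<^sub>M borel"
  shows "(\<lambda>x. theta (g x) (f x)) \<in> M \<rightarrow>\<^sub>M FF"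
proof -
  have "(\<lambda>x. fst ((\<lambda>(\<omega>, s). (theta s \<omega>, \<omega> 0)) (f x, g x))) \<in> M \<rightarrow>\<^sub>M FF"
    using shift_eval_measurable by measurable
  then show ?thesis by simp
qed

lemma measurable_dil [measurable (raw)]:
  assumes [measurable]: "f \<in> M \<rightarrow>\<^sub>M FF" "g \<in> M \<rightarrow>\<^sub>M borel"
  shows "(\<lambda>x. dil (g x) (f x)) \<in> M \<rightarrow>\<^sub>M FF"
proof -
  have [measurable]: "(\<lambda>x. if g x > 0 then g x else 1) \<in> M \<rightarrow>\<^sub>M restrict_space borel {0<..}"
    by (rule measurable_restrict_space2) auto
  have "(\<lambda>x. (\<lambda>(\<omega>, u). smul u \<circ> \<omega>) (f x, if g x > 0 then g x else 1)) \<in> M \<rightarrow>\<^sub>M FF"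
    using scale_fun_measurable by measurable
  then show ?thesis by (simp add: dil_def)
qed

text \<open>The setting provides evaluation at 0; evaluation at \<open>g x\<close> is obtained from
  it by first shifting the path.\<close>

lemma measurable_eval:
  assumes [measurable]: "f \<in> M \<rightarrow>\<^sub>M FF" "g \<in> M \<rightarrow>\<^sub>M borel"
  shows "(\<lambda>x. f x (g x)) \<in> M \<rightarrow>\<^sub>M borel"
proof -
  have "(\<lambda>x. snd ((\<lambda>(\<omega>, s). (theta s \<omega>, \<omega> 0)) (theta (g x) (f x), 0))) \<in> M \<rightarrow>\<^sub>M borel"
    using shift_eval_measurable by measurable
  then show ?thesis by (simp add: theta_def)
qed

lemma measurable_mag_eval [measurable (raw)]:
  assumes "f \<in> M \<rightarrow>\<^sub>M FF" "g \<in> M \<rightarrow>\<^sub>M borel"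
  shows "(\<lambda>x. mag (f x (g x))) \<in> M \<rightarrow>\<^sub>M borel"
  using measurable_compose[OF measurable_eval[OF assms] mag_measurable] .

lemma dil_in_space [simp]: "\<omega> \<in> space FF \<Longrightarrow> dil u \<omega> \<in> space FF"
  by (simp add: dil_def scale_closed)

lemma xi_dil_measurable:
  assumes [measurable]: "B \<in> sets borel"
  shows "(\<lambda>\<omega>. xi lam mag (dil u \<omega>) B) \<in> borel_measurable FF"
  unfolding xi_def by measurable

end

section \<open>Mass, orbit integrals and the orbit weight\<close>

locale tail_index = tail_setting lam smul mag FF
  for lam :: "'g::{topological_ab_group_add, t2_space, second_countable_topology} measure"
    and smul :: "real \<Rightarrow> 'h::polish_space \<Rightarrow> 'h"
    and mag :: "'h \<Rightarrow> real"
    and FF :: "('g \<Rightarrow> 'h) measure" +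
  fixes \<alpha> :: real
  assumes \<alpha>_pos: "\<alpha> > 0"
begin

definition mass :: "('g \<Rightarrow> 'h) \<Rightarrow> ennreal" where
  "mass \<omega> = (\<integral>\<^sup>+ s. ennreal (mag (\<omega> s) powr \<alpha>) \<partial>lam)"

lemma measurable_mass [measurable]: "mass \<in> borel_measurable FF"
  unfolding mass_def by measurable

lemma mass_theta:
  assumes [measurable]: "\<omega> \<in> space FF"
  shows "mass (theta t \<omega>) = mass \<omega>"
  unfolding mass_def theta_def
  by (rule nn_integral_haar_translate[OF haar]) measurable

lemma mass_dil:
  assumes "u > 0" and [measurable]: "\<omega> \<in> space FF"
  shows "mass (dil u \<omega>) = ennreal (u powr \<alpha>) * mass \<omega>"
  using assms(1)
  by (simp add: mass_def mag_dil powr_mult mag_nonneg ennreal_mult nn_integral_cmult)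

definition pareto :: "real \<Rightarrow> ennreal" where
  "pareto u = ennreal (\<alpha> * u powr (- \<alpha> - 1)) * indicator {0<..} u"

lemma measurable_pareto [measurable]: "pareto \<in> borel_measurable borel"
  unfolding pareto_def by measurable

text \<open>The image of Haar times Pareto measure along the orbit of \<open>\<omega>\<close>,
  evaluated at \<open>A\<close>; integrating it over \<open>Q\<close> gives the right-hand side of
  the representation.\<close>

definition orbit :: "('g \<Rightarrow> 'h) set \<Rightarrow> ('g \<Rightarrow> 'h) \<Rightarrow> ennreal" where
  "orbit A \<omega> = (\<integral>\<^sup>+ s. (\<integral>\<^sup>+ u. indicator A (dil u (theta s \<omega>)) * pareto u \<partial>lborel) \<partial>lam)"

text \<open>Links \<open>orbit\<close> with the integrand of the theorem; the default of
  \<open>dil\<close> at nonpositive \<open>u\<close> is harmless because \<open>pareto\<close>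
  vanishes there.\<close>

lemma orbit_altdef:
  "orbit A \<omega> = (\<integral>\<^sup>+ s. (\<integral>\<^sup>+ u. indicator {u. u > 0 \<and> smul u \<circ> theta s \<omega> \<in> A} u
      * ennreal (\<alpha> * u powr (- \<alpha> - 1)) \<partial>lborel) \<partial>lam)"
  unfolding orbit_def pareto_def
  by (intro nn_integral_cong) (auto simp: indicator_def dil_pos)

lemma measurable_orbit [measurable]:
  assumes [measurable]: "A \<in> sets FF"
  shows "orbit A \<in> borel_measurable FF"
  unfolding orbit_def by measurable

text \<open>Dilations commute with shifts, so only the radial integral changes. Substituting
  \<open>c * u\<close> for \<open>u\<close> there, the scaling of the Pareto density produces the
  factor.\<close>

lemma orbit_dil:
  assumes c: "c > 0" and [measurable]: "\<omega> \<in> space FF" "A \<in> sets FF"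
  shows "orbit A (dil c \<omega>) = ennreal (c powr \<alpha>) * orbit A \<omega>"
proof -
  have "(\<integral>\<^sup>+ u. indicator A (dil u (theta s (dil c \<omega>))) * pareto u \<partial>lborel)
      = ennreal (c powr \<alpha>) * (\<integral>\<^sup>+ u. indicator A (dil u (theta s \<omega>)) * pareto u \<partial>lborel)" for s
  proof -
    have "(\<integral>\<^sup>+ u. indicator A (dil u (theta s \<omega>)) * pareto u \<partial>lborel)
        = ennreal c * (\<integral>\<^sup>+ u. indicator A (dil (c * u) (theta s \<omega>)) * pareto (c * u) \<partial>lborel)"
      using c by (subst nn_integral_real_affine[where c = c and t = 0]) auto
    also have "\<dots> = (\<integral>\<^sup>+ u. ennreal c * (indicator A (dil (c * u) (theta s \<omega>)) * pareto (c * u)) \<partial>lborel)"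
      by (simp add: nn_integral_cmult)
    finally have "ennreal (c powr \<alpha>) * (\<integral>\<^sup>+ u. indicator A (dil u (theta s \<omega>)) * pareto u \<partial>lborel)
        = (\<integral>\<^sup>+ u. ennreal (c powr \<alpha>) * (ennreal c * (indicator A (dil (c * u) (theta s \<omega>)) * pareto (c * u))) \<partial>lborel)"
      by (simp add: nn_integral_cmult)
    also have "\<dots> = (\<integral>\<^sup>+ u. indicator A (dil u (theta s (dil c \<omega>))) * pareto u \<partial>lborel)"
    proof (rule nn_integral_cong)
      fix u
      have "c powr \<alpha> * (c * (\<alpha> * (c * u) powr (- \<alpha> - 1))) = \<alpha> * u powr (- \<alpha> - 1)" if "u > 0"
        using that c by (simp add: powr_mult powr_diff powr_minus field_simps)
      then have "ennreal (c powr \<alpha>) * (ennreal c * pareto (c * u)) = pareto u"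
        using c \<alpha>_pos
        by (cases "u > 0") (auto simp: pareto_def zero_less_mult_iff simp flip: ennreal_mult)
      moreover have "u > 0 \<Longrightarrow> dil u (theta s (dil c \<omega>)) = dil (c * u) (theta s \<omega>)"
        using c by (simp add: theta_dil dil_dil mult.commute)
      ultimately show "ennreal (c powr \<alpha>) * (ennreal c * (indicator A (dil (c * u) (theta s \<omega>)) * pareto (c * u)))
          = indicator A (dil u (theta s (dil c \<omega>))) * pareto u"
        by (cases "u > 0") (auto simp: indicator_def pareto_def)
    qed
    finally show ?thesis ..
  qed
  then show ?thesis
    by (simp add: orbit_def nn_integral_cmult)
qed

text \<open>At each \<open>s\<close> the radial integral is a Pareto tail with
  \<open>m = mag (\<omega> s)\<close>. Through this identity the normalization of \<nu> fixes the
  mean of \<open>mass\<close> under a representing measure.\<close>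

lemma orbit_exceedance:
  assumes [measurable]: "\<omega> \<in> space FF"
  shows "orbit {\<omega> \<in> space FF. mag (\<omega> 0) > 1} \<omega> = mass \<omega>"
  unfolding orbit_def mass_def
proof (rule nn_integral_cong)
  fix s
  have "(\<integral>\<^sup>+ u. indicator {\<omega> \<in> space FF. mag (\<omega> 0) > 1} (dil u (theta s \<omega>)) * pareto u \<partial>lborel)
      = (\<integral>\<^sup>+ u. indicator {u. 1 < u * mag (\<omega> s)} u * (ennreal (\<alpha> * u powr (- \<alpha> - 1)) * indicator {0<..} u) \<partial>lborel)"
    using assms by (intro nn_integral_cong) (auto simp: pareto_def indicator_def mag_dil theta_apply)
  then show "(\<integral>\<^sup>+ u. indicator {\<omega> \<in> space FF. mag (\<omega> 0) > 1} (dil u (theta s \<omega>)) * pareto u \<partial>lborel)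
      = ennreal (mag (\<omega> s) powr \<alpha>)"
    using nn_integral_Pareto_tail[OF \<alpha>_pos mag_nonneg] by simp
qed

text \<open>The root makes it homogeneous of degree one: if \<open>rad \<omega> > 0\<close>,
  dilating by \<open>1 / rad \<omega>\<close> gives a path of mass 1.\<close>

definition rad :: "('g \<Rightarrow> 'h) \<Rightarrow> real" where
  "rad \<omega> = enn2real (mass \<omega>) powr (1 / \<alpha>)"

lemma measurable_rad [measurable]: "rad \<in> borel_measurable FF"
  unfolding rad_def by measurable

text \<open>The junk value of \<open>enn2real\<close> makes \<open>rad\<close> vanish exactly when \<open>mass\<close> is \<open>0\<close> or \<open>\<infinity>\<close>.\<close>
lemma rad_pos_iff: "rad \<omega> > 0 \<longleftrightarrow> mass \<omega> \<noteq> 0 \<and> mass \<omega> \<noteq> \<infinity>"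
  by (cases "mass \<omega>") (auto simp: rad_def)

lemma mass_eq_rad: "rad \<omega> > 0 \<Longrightarrow> mass \<omega> = ennreal (rad \<omega> powr \<alpha>)"
  using \<alpha>_pos unfolding rad_pos_iff by (cases "mass \<omega>") (auto simp: rad_def powr_powr)

lemma rad_theta: "\<omega> \<in> space FF \<Longrightarrow> rad (theta s \<omega>) = rad \<omega>"
  by (simp add: rad_def mass_theta)

lemma rad_dil: "u > 0 \<Longrightarrow> \<omega> \<in> space FF \<Longrightarrow> rad (dil u \<omega>) = u * rad \<omega>"
  using \<alpha>_pos by (simp add: rad_def mass_dil enn2real_mult powr_mult powr_powr)

text \<open>This is \<open>h\<close> of the opening sketch. If \<open>rad \<omega> > 0\<close>, the
  power integrates to 1 over shifts and the window to 1 over dilations. The window excludes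
  \<open>rad \<omega> = 0\<close>, so the weight vanishes where the mass is 0 or infinite.\<close>

definition weight :: "('g \<Rightarrow> 'h) \<Rightarrow> ennreal" where
  "weight \<omega> = ennreal ((mag (\<omega> 0) / rad \<omega>) powr \<alpha>) * indicator {1..exp (1 / \<alpha>)} (rad \<omega>)"

lemma measurable_weight [measurable]: "weight \<in> borel_measurable FF"
  unfolding weight_def by measurable

text \<open>Since \<open>mag (\<omega> 0) / rad \<omega>\<close> is unchanged by dilations and
  \<open>rad\<close> by shifts, the integrand factorizes. The radial part is 1 by
  \<open>nn_integral_inverse_exp\<close>; the spatial part is, after a reflection, the mass of the
  path divided by its radius.\<close>

lemma weight_orbit:
  assumes [measurable]: "\<omega> \<in> space FF" and rad: "rad \<omega> > 0"
  shows "(\<integral>\<^sup>+ s. (\<integral>\<^sup>+ u. weight (dil (1 / u) (theta (- s) \<omega>)) * (ennreal (\<alpha> / u) * indicator {0<..} u) \<partial>lborel) \<partial>lam) = 1"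
proof -
  have "(\<integral>\<^sup>+ u. weight (dil (1 / u) (theta (- s) \<omega>)) * (ennreal (\<alpha> / u) * indicator {0<..} u) \<partial>lborel)
      = ennreal ((mag (\<omega> (- s)) / rad \<omega>) powr \<alpha>)" for s
  proof -
    have "(\<integral>\<^sup>+ u. weight (dil (1 / u) (theta (- s) \<omega>)) * (ennreal (\<alpha> / u) * indicator {0<..} u) \<partial>lborel)
        = (\<integral>\<^sup>+ u. ennreal ((mag (\<omega> (- s)) / rad \<omega>) powr \<alpha>) *
            (indicator {1..exp (1 / \<alpha>)} (rad \<omega> / u) * (ennreal (\<alpha> / u) * indicator {0<..} u)) \<partial>lborel)"
    proof (rule nn_integral_cong)
      fix u
      have "weight (dil (1 / u) (theta (- s) \<omega>)) = ennreal ((mag (\<omega> (- s)) / rad \<omega>) powr \<alpha>) * indicator {1..exp (1 / \<alpha>)} (rad \<omega> / u)"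
        if "u > 0"
        using that assms(1) by (simp add: weight_def rad_dil rad_theta mag_dil theta_apply)
      then show "weight (dil (1 / u) (theta (- s) \<omega>)) * (ennreal (\<alpha> / u) * indicator {0<..} u) =
          ennreal ((mag (\<omega> (- s)) / rad \<omega>) powr \<alpha>) *
            (indicator {1..exp (1 / \<alpha>)} (rad \<omega> / u) * (ennreal (\<alpha> / u) * indicator {0<..} u))"
        by (cases "u > 0") (auto simp: mult.assoc)
    qed
    also have "\<dots> = ennreal ((mag (\<omega> (- s)) / rad \<omega>) powr \<alpha>)"
      by (simp add: nn_integral_cmult nn_integral_inverse_exp[OF \<alpha>_pos rad])
    finally show ?thesis .
  qed
  then have "(\<integral>\<^sup>+ s. (\<integral>\<^sup>+ u. weight (dil (1 / u) (theta (- s) \<omega>)) * (ennreal (\<alpha> / u) * indicator {0<..} u) \<partial>lborel) \<partial>lam)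
      = (\<integral>\<^sup>+ s. ennreal ((mag (\<omega> (- s)) / rad \<omega>) powr \<alpha>) \<partial>lam)"
    by simp
  also have "\<dots> = (\<integral>\<^sup>+ s. ennreal ((mag (\<omega> s) / rad \<omega>) powr \<alpha>) \<partial>lam)"
    by (rule nn_integral_haar_uminus[OF locally_compact haar, of "\<lambda>s. ennreal ((mag (\<omega> s) / rad \<omega>) powr \<alpha>)"]) measurable
  also have "\<dots> = mass (dil (1 / rad \<omega>) \<omega>)"
    using rad by (simp add: mass_def mag_dil)
  also have "\<dots> = ennreal ((1 / rad \<omega>) powr \<alpha>) * ennreal (rad \<omega> powr \<alpha>)"
    using assms by (simp add: mass_dil mass_eq_rad)
  also have "\<dots> = 1"
    using rad by (simp add: powr_divide flip: ennreal_mult)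
  finally show ?thesis .
qed

end

section \<open>Stationary tail measures\<close>

locale stationary_tail = tail_index lam smul mag FF \<alpha>
  for lam :: "'g::{topological_ab_group_add, t2_space, second_countable_topology} measure"
    and smul :: "real \<Rightarrow> 'h::polish_space \<Rightarrow> 'h"
    and mag :: "'h \<Rightarrow> real"
    and FF :: "('g \<Rightarrow> 'h) measure"
    and \<alpha> :: real +
  fixes \<nu> :: "('g \<Rightarrow> 'h) measure"
  assumes stationary_tail: "stationary_tail_measure lam smul mag FF \<alpha> \<nu>"
begin

lemma sets_\<nu> [measurable_cong]: "sets \<nu> = sets FF"
  using stationary_tail by (simp add: stationary_tail_measure_def tail_measure_def)

lemma space_\<nu>: "space \<nu> = space FF"
  by (rule sets_eq_imp_space_eq) (rule sets_\<nu>)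

lemma emeasure_exceedance: "emeasure \<nu> {\<omega> \<in> space FF. mag (\<omega> 0) > 1} = 1"
  using stationary_tail by (simp add: stationary_tail_measure_def)

lemma nn_integral_theta:
  assumes [measurable]: "f \<in> borel_measurable FF"
  shows "(\<integral>\<^sup>+ \<omega>. f (theta s \<omega>) \<partial>\<nu>) = (\<integral>\<^sup>+ \<omega>. f \<omega> \<partial>\<nu>)"
proof -
  have "(\<integral>\<^sup>+ \<omega>. f \<omega> \<partial>\<nu>) = (\<integral>\<^sup>+ \<omega>. f \<omega> \<partial>distr \<nu> FF (theta s))"
    using stationary_tail by (simp add: stationary_tail_measure_def)
  also have "\<dots> = (\<integral>\<^sup>+ \<omega>. f (theta s \<omega>) \<partial>\<nu>)"
    by (rule nn_integral_distr) measurable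
  finally show ?thesis ..
qed

lemma nn_integral_dil:
  assumes u: "u > 0" and [measurable]: "f \<in> borel_measurable FF"
  shows "(\<integral>\<^sup>+ \<omega>. f (dil u \<omega>) \<partial>\<nu>) = ennreal (u powr \<alpha>) * (\<integral>\<^sup>+ \<omega>. f \<omega> \<partial>\<nu>)"
proof -
  have "distr \<nu> FF (dil u) = scale_measure (ennreal (u powr \<alpha>)) \<nu>"
  proof (rule measure_eqI)
    fix A assume "A \<in> sets (distr \<nu> FF (dil u))"
    then have [measurable]: "A \<in> sets FF" by simp
    have "emeasure (distr \<nu> FF (dil u)) A = emeasure \<nu> {\<omega> \<in> space FF. smul u \<circ> \<omega> \<in> A}"
      using u by (subst emeasure_distr)
        (auto simp: space_\<nu> dil_pos intro!: arg_cong[where f = "emeasure \<nu>"])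
    also have "\<dots> = ennreal (u powr \<alpha>) * emeasure \<nu> A"
      using stationary_tail u by (simp add: stationary_tail_measure_def tail_measure_def)
    finally show "emeasure (distr \<nu> FF (dil u)) A = emeasure (scale_measure (ennreal (u powr \<alpha>)) \<nu>) A"
      by simp
  qed (simp add: sets_\<nu>)
  then have "ennreal (u powr \<alpha>) * (\<integral>\<^sup>+ \<omega>. f \<omega> \<partial>\<nu>) = (\<integral>\<^sup>+ \<omega>. f \<omega> \<partial>distr \<nu> FF (dil u))"
    by (simp add: nn_integral_scale_measure)
  also have "\<dots> = (\<integral>\<^sup>+ \<omega>. f (dil u \<omega>) \<partial>\<nu>)"
    by (rule nn_integral_distr) measurable
  finally show ?thesis ..
qed

text \<open>Zero mass would mean \<open>mag (\<omega> s) = 0\<close> for almost all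
  \<open>s\<close>, which the first integral condition on tail measures excludes for almost every
  path.\<close>

lemma AE_mass_pos: "AE \<omega> in \<nu>. mass \<omega> > 0"
proof -
  have "AE \<omega> in \<nu>. (\<integral>\<^sup>+ s. indicator {s. mag (\<omega> s) > 0} s \<partial>lam) > 0"
    using stationary_tail by (simp add: stationary_tail_measure_def tail_measure_def)
  then show ?thesis
    using AE_space
  proof eventually_elim
    case (elim \<omega>)
    then have [measurable]: "\<omega> \<in> space FF" by (simp add: space_\<nu>)
    have "mass \<omega> \<noteq> 0"
    proof
      assume "mass \<omega> = 0"
      then have "AE s in lam. mag (\<omega> s) = 0"
        by (simp add: mass_def nn_integral_0_iff_AE)
      then have "(\<integral>\<^sup>+ s. indicator {s. mag (\<omega> s) > 0} s \<partial>lam) = (\<integral>\<^sup>+ s. 0 \<partial>lam)"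
        by (intro nn_integral_cong_AE) auto
      with elim show False by simp
    qed
    then show ?case by (simp add: zero_less_iff_neq_zero)
  qed
qed

text \<open>By homogeneity the exceedance measures over every level have locally finite intensity, and
  almost every path has a positive exceedance measure over some level.\<close>
sublocale \<nu>: sigma_finite_measure \<nu>
proof -
  obtain K :: "nat \<Rightarrow> 'g set" where K: "\<And>n. compact (K n)" "(\<Union>n. K n) = UNIV"
    using locally_compact_sigma_compact[OF locally_compact] by blast
  have [measurable]: "K n \<in> sets borel" for n
    using K by (simp add: compact_imp_closed)
  \<comment> \<open>Dilating by \<open>Suc k\<close> lowers the exceedance level from 1 to
    \<open>1 / Suc k\<close>; the successor keeps the factor positive.\<close>
  define f where "f = (\<lambda>(n, k::nat) \<omega>. xi lam mag (dil (Suc k) \<omega>) (K n))"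
  show "sigma_finite_measure \<nu>"
  proof (rule sigma_finite_measure_if_countable_integrable)
    show "f p \<in> borel_measurable \<nu>" for p
      unfolding f_def by (cases p) (simp add: measurable_cong_sets[OF sets_\<nu> refl] xi_dil_measurable)
    show "(\<integral>\<^sup>+ \<omega>. f p \<omega> \<partial>\<nu>) < \<infinity>" for p
    proof (cases p)
      case (Pair n k)
      have "(\<integral>\<^sup>+ \<omega>. f p \<omega> \<partial>\<nu>) = ennreal (real (Suc k) powr \<alpha>) * (\<integral>\<^sup>+ \<omega>. xi lam mag \<omega> (K n) \<partial>\<nu>)"
        using nn_integral_dil[of "Suc k" "\<lambda>\<omega>. xi lam mag \<omega> (K n)"] xi_dil_measurable[of "K n" 1]
        by (simp add: f_def Pair dil_1)
      moreover have "(\<integral>\<^sup>+ \<omega>. xi lam mag \<omega> (K n) \<partial>\<nu>) < \<infinity>"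
        using stationary_tail K by (simp add: stationary_tail_measure_def tail_measure_def)
      ultimately show ?thesis
        by (simp add: ennreal_mult_less_top)
    qed
    show "AE \<omega> in \<nu>. \<exists>p. f p \<omega> > 0"
      using AE_mass_pos AE_space
    proof eventually_elim
      case (elim \<omega>)
      then have [measurable]: "\<omega> \<in> space FF" by (simp add: space_\<nu>)
      show ?case
      proof (rule ccontr)
        assume "\<not> (\<exists>p. f p \<omega> > 0)"
        then have "f (n, k) \<omega> = 0" for n k
          by (auto simp: zero_less_iff_neq_zero)
        then have "AE s in lam. \<not> (s \<in> K n \<and> 1 < real (Suc k) * mag (\<omega> s))" for n k
          by (simp add: f_def xi_def nn_integral_0_iff_AE mag_dil indicator_eq_0_iff
            del: of_nat_Suc nn_integral_indicator nn_integral_indicator')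
        then have "AE s in lam. \<forall>n k. \<not> (s \<in> K n \<and> 1 < real (Suc k) * mag (\<omega> s))"
          unfolding AE_all_countable by blast
        \<comment> \<open>Such an \<open>s\<close> lies in some \<open>K n\<close>, so
          \<open>mag (\<omega> s)\<close> is at most \<open>1 / Suc k\<close> for every
          \<open>k\<close> and vanishes.\<close>
        then have "AE s in lam. mag (\<omega> s) = 0"
        proof eventually_elim
          case (elim s)
          obtain n where "s \<in> K n" using K(2) by blast
          show ?case
          proof (rule ccontr)
            assume "mag (\<omega> s) \<noteq> 0"
            then have "mag (\<omega> s) > 0" using mag_nonneg[of "\<omega> s"] by simp
            then obtain m where m: "1 < real m * mag (\<omega> s)"
              using reals_Archimedean3 by blast
            then have "m \<noteq> 0" by (intro notI) simp
            then obtain k where "m = Suc k" by (cases m) auto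
            with m elim \<open>s \<in> K n\<close> show False by blast
          qed
        qed
        then have "mass \<omega> = 0"
          by (simp add: mass_def nn_integral_0_iff_AE)
        with elim show False by simp
      qed
    qed
  qed
qed

text \<open>For fixed \<open>s\<close> and \<open>u\<close>, stationarity and homogeneity of \<nu>
  move the action from \<open>A\<close> to \<open>h\<close>, where it appears inverted, at the cost
  of a factor \<open>u powr \<alpha>\<close>. That factor turns the Pareto density into
  \<open>\<alpha> / u\<close>.\<close>

lemma nn_integral_orbit_swap:
  assumes [measurable]: "h \<in> borel_measurable FF" "A \<in> sets FF"
  shows "(\<integral>\<^sup>+ \<omega>. h \<omega> * orbit A \<omega> \<partial>\<nu>) = (\<integral>\<^sup>+ \<omega>. indicator A \<omega> *
    (\<integral>\<^sup>+ s. (\<integral>\<^sup>+ u. h (dil (1 / u) (theta (- s) \<omega>)) * (ennreal (\<alpha> / u) * indicator {0<..} u) \<partial>lborel) \<partial>lam) \<partial>\<nu>)"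
proof -
  \<comment> \<open>The exchange rests on the sigma-finiteness of \<nu>; it makes the path integral
    innermost, where the invariances act with \<open>s\<close> and \<open>u\<close> fixed.\<close>
  have Fubini3: "(\<integral>\<^sup>+ \<omega>. (\<integral>\<^sup>+ s. (\<integral>\<^sup>+ u. f \<omega> s u \<partial>lborel) \<partial>lam) \<partial>\<nu>)
      = (\<integral>\<^sup>+ s. (\<integral>\<^sup>+ u. (\<integral>\<^sup>+ \<omega>. f \<omega> s u \<partial>\<nu>) \<partial>lborel) \<partial>lam)"
    if f: "(\<lambda>x. f (fst (fst x)) (snd (fst x)) (snd x)) \<in> borel_measurable ((FF \<Otimes>\<^sub>M borel) \<Otimes>\<^sub>M borel)"
    for f :: "('g \<Rightarrow> 'h) \<Rightarrow> 'g \<Rightarrow> real \<Rightarrow> ennreal"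
  proof -
    have [measurable (raw)]: "(\<lambda>x. f (a x) (b x) (c x)) \<in> borel_measurable M"
      if [measurable]: "a \<in> M \<rightarrow>\<^sub>M FF" "b \<in> M \<rightarrow>\<^sub>M borel" "c \<in> M \<rightarrow>\<^sub>M borel"
      for a b c and M :: "'m measure"
      using measurable_compose[OF _ f, of "\<lambda>x. ((a x, b x), c x)" M] by simp
    interpret lu: pair_sigma_finite lborel \<nu> ..
    interpret ls: pair_sigma_finite lam \<nu> ..
    have "(\<integral>\<^sup>+ \<omega>. (\<integral>\<^sup>+ s. (\<integral>\<^sup>+ u. f \<omega> s u \<partial>lborel) \<partial>lam) \<partial>\<nu>)
        = (\<integral>\<^sup>+ s. (\<integral>\<^sup>+ \<omega>. (\<integral>\<^sup>+ u. f \<omega> s u \<partial>lborel) \<partial>\<nu>) \<partial>lam)"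
      by (rule ls.Fubini') measurable
    also have "\<dots> = (\<integral>\<^sup>+ s. (\<integral>\<^sup>+ u. (\<integral>\<^sup>+ \<omega>. f \<omega> s u \<partial>\<nu>) \<partial>lborel) \<partial>lam)"
      by (rule nn_integral_cong, rule lu.Fubini') measurable
    finally show ?thesis .
  qed
  have inner: "(\<integral>\<^sup>+ \<omega>. h \<omega> * (indicator A (dil u (theta s \<omega>)) * pareto u) \<partial>\<nu>)
      = (\<integral>\<^sup>+ \<omega>. indicator A \<omega> * (h (dil (1 / u) (theta (- s) \<omega>)) * (ennreal (\<alpha> / u) * indicator {0<..} u)) \<partial>\<nu>)"
    for s u
  proof (cases "u > 0")
    case u: True
    \<comment> \<open>Chosen so that at \<open>dil u (theta s \<omega>)\<close> the inverse actions
      cancel, leaving \<open>h \<omega>\<close> times the indicator of \<open>A\<close> at that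
      image.\<close>
    define g where "g \<omega> = h (dil (1 / u) (theta (- s) \<omega>)) * indicator A \<omega>" for \<omega>
    have [measurable]: "g \<in> borel_measurable FF"
      unfolding g_def by measurable
    have c: "u powr \<alpha> * (\<alpha> * u powr (- \<alpha> - 1)) = \<alpha> / u"
      using u by (simp add: powr_diff powr_minus field_simps)
    have "(\<integral>\<^sup>+ \<omega>. h \<omega> * (indicator A (dil u (theta s \<omega>)) * pareto u) \<partial>\<nu>)
        = (\<integral>\<^sup>+ \<omega>. g (dil u (theta s \<omega>)) * pareto u \<partial>\<nu>)"
      using u by (simp add: g_def theta_dil dil_dil dil_1 theta_theta theta_0 mult.assoc)
    also have "\<dots> = (\<integral>\<^sup>+ \<omega>. g (dil u (theta s \<omega>)) \<partial>\<nu>) * pareto u"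
      by (rule nn_integral_multc) measurable
    also have "(\<integral>\<^sup>+ \<omega>. g (dil u (theta s \<omega>)) \<partial>\<nu>) = ennreal (u powr \<alpha>) * (\<integral>\<^sup>+ \<omega>. g \<omega> \<partial>\<nu>)"
      using nn_integral_theta[of "\<lambda>\<omega>. g (dil u \<omega>)" s] nn_integral_dil[OF u, of g] by simp
    also have "\<dots> * pareto u = (\<integral>\<^sup>+ \<omega>. g \<omega> \<partial>\<nu>) * (ennreal (\<alpha> / u) * indicator {0<..} u)"
      using u \<alpha>_pos by (simp add: pareto_def ac_simps flip: c) (simp add: ennreal_mult ac_simps)
    also have "\<dots> = (\<integral>\<^sup>+ \<omega>. g \<omega> * (ennreal (\<alpha> / u) * indicator {0<..} u) \<partial>\<nu>)"
      by (rule nn_integral_multc[symmetric]) measurable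
    finally show ?thesis
      by (simp add: g_def ac_simps)
  qed (simp add: pareto_def)
  have "(\<integral>\<^sup>+ \<omega>. h \<omega> * orbit A \<omega> \<partial>\<nu>)
      = (\<integral>\<^sup>+ \<omega>. (\<integral>\<^sup>+ s. (\<integral>\<^sup>+ u. h \<omega> * (indicator A (dil u (theta s \<omega>)) * pareto u) \<partial>lborel) \<partial>lam) \<partial>\<nu>)"
    by (rule nn_integral_cong) (simp add: orbit_def space_\<nu> nn_integral_cmult)
  also have "\<dots> = (\<integral>\<^sup>+ s. (\<integral>\<^sup>+ u. (\<integral>\<^sup>+ \<omega>. h \<omega> * (indicator A (dil u (theta s \<omega>)) * pareto u) \<partial>\<nu>) \<partial>lborel) \<partial>lam)"
    by (rule Fubini3) measurable
  also have "\<dots> = (\<integral>\<^sup>+ \<omega>. (\<integral>\<^sup>+ s. (\<integral>\<^sup>+ u. indicator A \<omega> *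
      (h (dil (1 / u) (theta (- s) \<omega>)) * (ennreal (\<alpha> / u) * indicator {0<..} u)) \<partial>lborel) \<partial>lam) \<partial>\<nu>)"
    unfolding inner by (rule Fubini3[symmetric]) measurable
  also have "\<dots> = (\<integral>\<^sup>+ \<omega>. indicator A \<omega> *
      (\<integral>\<^sup>+ s. (\<integral>\<^sup>+ u. h (dil (1 / u) (theta (- s) \<omega>)) * (ennreal (\<alpha> / u) * indicator {0<..} u) \<partial>lborel) \<partial>lam) \<partial>\<nu>)"
    by (rule nn_integral_cong) (simp add: space_\<nu> nn_integral_cmult)
  finally show ?thesis .
qed

section \<open>Representable tail measures have finite mass\<close>

lemma AE_mass_finite:
  assumes "sets Q = sets FF" and rep: "\<And>A. A \<in> sets FF \<Longrightarrow> emeasure \<nu> A = (\<integral>\<^sup>+ \<omega>. orbit A \<omega> \<partial>Q)"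
  shows "AE \<omega> in \<nu>. mass \<omega> < \<infinity>"
proof -
  note [measurable_cong] = \<open>sets Q = sets FF\<close>
  have space_Q: "space Q = space FF"
    by (rule sets_eq_imp_space_eq) fact
  have "(\<integral>\<^sup>+ \<omega>. mass \<omega> \<partial>Q) = (\<integral>\<^sup>+ \<omega>. orbit {\<omega> \<in> space FF. mag (\<omega> 0) > 1} \<omega> \<partial>Q)"
    by (intro nn_integral_cong) (simp add: orbit_exceedance space_Q)
  also have "\<dots> = 1"
    using rep[of "{\<omega> \<in> space FF. mag (\<omega> 0) > 1}"] emeasure_exceedance by simp
  finally have fin: "AE \<omega> in Q. mass \<omega> \<noteq> \<infinity>"
    by (intro nn_integral_noteq_infinite) auto
  \<comment> \<open>\<open>Z\<close> is invariant under shifts and positive dilations, so the orbit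
    of a path of finite mass never meets it.\<close>
  define Z where "Z = {\<omega> \<in> space FF. mass \<omega> = \<infinity>}"
  have [measurable]: "Z \<in> sets FF"
    unfolding Z_def by measurable
  have "AE \<omega> in Q. orbit Z \<omega> = 0"
    using fin AE_space
  proof eventually_elim
    case (elim \<omega>)
    then have \<omega>: "\<omega> \<in> space FF" by (simp add: space_Q)
    have "indicator Z (dil u (theta s \<omega>)) * pareto u = (0 :: ennreal)" for u s
      using elim \<omega> by (cases "u > 0")
        (auto simp: Z_def pareto_def indicator_def mass_dil mass_theta ennreal_mult_eq_top_iff)
    then show ?case by (simp only: orbit_def nn_integral_const mult_zero_left)
  qed
  then have "emeasure \<nu> Z = 0"
    by (simp add: rep nn_integral_0_iff_AE)
  then have "Z \<in> null_sets \<nu>"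
    by (simp add: null_setsI sets_\<nu>)
  then have "AE \<omega> in \<nu>. \<omega> \<notin> Z"
    by (rule AE_not_in)
  then show ?thesis
    using AE_space by eventually_elim (auto simp: Z_def space_\<nu> less_top)
qed

section \<open>Construction of the representing probability measure\<close>

lemma ex_representation:
  assumes "AE \<omega> in \<nu>. mass \<omega> < \<infinity>"
  obtains Q where "prob_space Q" "sets Q = sets FF"
    "\<And>A. A \<in> sets FF \<Longrightarrow> emeasure \<nu> A = (\<integral>\<^sup>+ \<omega>. orbit A \<omega> \<partial>Q)"
proof -
  \<comment> \<open>The density \<open>weight\<close> alone already represents \<nu>; the factor
    \<open>mass\<close> compensates for the subsequent division of paths by \<open>rad\<close>,
    which divides \<open>orbit A\<close> by the mass.\<close>
  define R where "R = density \<nu> (\<lambda>\<omega>. mass \<omega> * weight \<omega>)"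
  define Q where "Q = distr R FF (\<lambda>\<omega>. dil (1 / rad \<omega>) \<omega>)"
  have [measurable_cong]: "sets R = sets FF"
    by (simp add: R_def sets_\<nu>)
  have sets_Q: "sets Q = sets FF"
    by (simp add: Q_def)
  have Q: "(\<integral>\<^sup>+ \<omega>. f \<omega> \<partial>Q) = (\<integral>\<^sup>+ \<omega>. mass \<omega> * weight \<omega> * f (dil (1 / rad \<omega>) \<omega>) \<partial>\<nu>)"
    if [measurable]: "f \<in> borel_measurable FF" for f
    unfolding Q_def R_def
    by (subst nn_integral_distr, measurable, subst nn_integral_density) measurable
  have weight_rad: "rad \<omega> > 0" if "weight \<omega> \<noteq> 0" for \<omega>
    using that by (auto simp: weight_def indicator_def split: if_splits)
  have unit: "ennreal (rad \<omega> powr \<alpha>) * ennreal ((1 / rad \<omega>) powr \<alpha>) = 1" if "rad \<omega> > 0" for \<omega>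
    using that by (simp add: powr_divide flip: ennreal_mult)
  have rep: "emeasure \<nu> A = (\<integral>\<^sup>+ \<omega>. orbit A \<omega> \<partial>Q)" if [measurable]: "A \<in> sets FF" for A
  proof -
    have "(\<integral>\<^sup>+ \<omega>. orbit A \<omega> \<partial>Q) = (\<integral>\<^sup>+ \<omega>. weight \<omega> * orbit A \<omega> \<partial>\<nu>)"
      unfolding Q[OF measurable_orbit[OF that]]
    proof (rule nn_integral_cong)
      fix \<omega> assume \<omega>: "\<omega> \<in> space \<nu>"
      show "mass \<omega> * weight \<omega> * orbit A (dil (1 / rad \<omega>) \<omega>) = weight \<omega> * orbit A \<omega>"
      \<comment> \<open>Where the weight is zero both sides vanish, whatever
        \<open>1 / rad \<omega>\<close> is; elsewhere \<open>mass \<omega>\<close> cancels the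
        factor from \<open>orbit_dil\<close>.\<close>
      proof (cases "weight \<omega> = 0")
        case False
        then have r: "rad \<omega> > 0" by (rule weight_rad)
        then have "mass \<omega> * weight \<omega> * orbit A (dil (1 / rad \<omega>) \<omega>)
            = (ennreal (rad \<omega> powr \<alpha>) * ennreal ((1 / rad \<omega>) powr \<alpha>)) * (weight \<omega> * orbit A \<omega>)"
          using \<omega> that by (simp add: orbit_dil space_\<nu> mass_eq_rad ac_simps)
        then show ?thesis
          using unit[OF r] by simp
      qed simp
    qed
    also have "\<dots> = (\<integral>\<^sup>+ \<omega>. indicator A \<omega> *
        (\<integral>\<^sup>+ s. (\<integral>\<^sup>+ u. weight (dil (1 / u) (theta (- s) \<omega>)) * (ennreal (\<alpha> / u) * indicator {0<..} u) \<partial>lborel) \<partial>lam) \<partial>\<nu>)"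
      by (rule nn_integral_orbit_swap) measurable
    \<comment> \<open>By \<open>weight_orbit\<close> the orbit integral is 1 wherever the mass is
      positive and finite, hence almost everywhere.\<close>
    also have "\<dots> = (\<integral>\<^sup>+ \<omega>. indicator A \<omega> \<partial>\<nu>)"
    proof (rule nn_integral_cong_AE)
      show "AE \<omega> in \<nu>. indicator A \<omega> *
          (\<integral>\<^sup>+ s. (\<integral>\<^sup>+ u. weight (dil (1 / u) (theta (- s) \<omega>)) * (ennreal (\<alpha> / u) * indicator {0<..} u) \<partial>lborel) \<partial>lam)
          = indicator A \<omega>"
        using assms AE_mass_pos AE_space
      proof eventually_elim
        case (elim \<omega>)
        then have "rad \<omega> > 0" "\<omega> \<in> space FF"
          by (auto simp: rad_pos_iff space_\<nu>)
        then show ?case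
          by (simp only: weight_orbit mult_1_right)
      qed
    qed
    also have "\<dots> = emeasure \<nu> A"
      by simp
    finally show ?thesis ..
  qed
  \<comment> \<open>Almost every path under \<open>Q\<close> has mass 1, so the total mass of
    \<open>Q\<close> equals the mean of \<open>mass\<close>, which \<open>orbit_exceedance\<close>
    and the normalization of \<nu> identify as 1.\<close>
  have "(\<integral>\<^sup>+ \<omega>. 1 \<partial>Q) = (\<integral>\<^sup>+ \<omega>. mass \<omega> * weight \<omega> * 1 \<partial>\<nu>)"
    by (rule Q) simp
  also have "\<dots> = (\<integral>\<^sup>+ \<omega>. mass \<omega> * weight \<omega> * mass (dil (1 / rad \<omega>) \<omega>) \<partial>\<nu>)"
  proof (rule nn_integral_cong)
    fix \<omega> assume "\<omega> \<in> space \<nu>"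
    then show "mass \<omega> * weight \<omega> * 1 = mass \<omega> * weight \<omega> * mass (dil (1 / rad \<omega>) \<omega>)"
      using weight_rad[of \<omega>] unit[of \<omega>]
      by (cases "weight \<omega> = 0") (auto simp: mass_dil space_\<nu> mass_eq_rad ac_simps)
  qed
  also have "\<dots> = (\<integral>\<^sup>+ \<omega>. mass \<omega> \<partial>Q)"
    by (rule Q[symmetric]) measurable
  also have "\<dots> = (\<integral>\<^sup>+ \<omega>. orbit {\<omega> \<in> space FF. mag (\<omega> 0) > 1} \<omega> \<partial>Q)"
    by (intro nn_integral_cong) (simp add: orbit_exceedance Q_def)
  also have "\<dots> = 1"
    using rep[of "{\<omega> \<in> space FF. mag (\<omega> 0) > 1}"] emeasure_exceedance by simp
  finally have "prob_space Q"
    by (intro prob_spaceI) simp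
  then show thesis
    using that sets_Q rep by blast
qed

end

theorem theorem7p6:
  fixes lam :: "'g::{topological_ab_group_add, t2_space, second_countable_topology} measure"
    and smul :: "real \<Rightarrow> 'h::polish_space \<Rightarrow> 'h"
    and mag :: "'h \<Rightarrow> real"
    and FF :: "('g \<Rightarrow> 'h) measure"
    and \<alpha> :: real
    and \<nu> :: "('g \<Rightarrow> 'h) measure"
  assumes "tail_setting lam smul mag FF"
    and "\<alpha> > 0"
    and "stationary_tail_measure lam smul mag FF \<alpha> \<nu>"
  shows "(\<exists>Q. prob_space Q \<and> sets Q = sets FF \<and>
            (\<forall>A\<in>sets FF.
               emeasure \<nu> A =
                 (\<integral>\<^sup>+ \<omega>. (\<integral>\<^sup>+ s. (\<integral>\<^sup>+ u.
                    indicator {u. u > 0 \<and> smul u \<circ> theta s \<omega> \<in> A} u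
                      * ennreal (\<alpha> * u powr (- \<alpha> - 1)) \<partial>lborel) \<partial>lam) \<partial>Q)))
         \<longleftrightarrow> (AE \<omega> in \<nu>. (\<integral>\<^sup>+ s. ennreal (mag (\<omega> s) powr \<alpha>) \<partial>lam) < \<infinity>)"
proof -
  interpret stationary_tail lam smul mag FF \<alpha> \<nu>
    using assms by (intro stationary_tail.intro tail_index.intro tail_index_axioms.intro stationary_tail_axioms.intro)
  show ?thesis
    unfolding orbit_altdef[symmetric] mass_def[symmetric]
    using AE_mass_finite ex_representation by metis
qed

end
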